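(* Let $\Phi$ be a commutative unital ring with $\frac{1}{2}\in\Phi$, let $G$ be a group (not assumed abelian), and let $L=\bigoplus_{g\in G}L_g$ be a Lie algebra over $\Phi$ graded by $G$. If $g,g'\in G$ satisfy $gg'\neq g'g$, then $[\mathrm{id}_L(L_g),\mathrm{id}_L(L_{g'})]=0$. In particular, if $L$ is graded-prime and $G$ is generated by the support $\mathrm{supp}(L)$, then $G$ is an abelian group.
   Context: A Lie algebra $L$ over $\Phi$ with bracket $[\ ,\ ]$ is graded by a group $G$ (written multiplicatively) if there is a decomposition $L=\bigoplus_{g\in G}L_g$, where each $L_g$ is a $\Phi$-submodule of $L$ (possibly zero) and $[L_g,L_{g'}]\subset L_{gg'}$ for all $g,g'\in G$. For an element $a=\sum_{g\in G}a_g\in L$ with $a_g\in L_g$, $\mathrm{supp}(a)=\{g\in G : a_g\neq 0\}$, and $\mathrm{supp}(L)=\bigcup_{a\in L}\mathrm{supp}(a)$ (equivalently, $\{g\in G: L_g\neq 0\}$). For a subset $S\subset L$, $\mathrm{id}_L(S)$ denotes the (Lie) ideal of $L$ generated by $S$. For ideals $I,J$ of $L$, $[I,J]=0$ means $[x,y]=0$ for all $x\in I$, $y\in J$. An ideal $I$ of $L$ is graded if $I=\bigoplus_{g\in G}(I\cap L_g)$. The $G$-graded Lie algebra $L$ is called graded-prime if there are no nonzero graded ideals $I,J$ of $L$ (possibly equal) with $[I,J]=0$. *)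

theory Defs
  imports "HOL-Algebra.Algebra"
begin

text \<open>
  A Lie algebra over \<open>R\<close> is an \<open>R\<close>-module \<open>L\<close> with a separately given bracket. The record
  type of modules extends that of rings; the ring fields \<open>mult\<close> and \<open>one\<close> of \<open>L\<close> are never used
  (the locale \<open>module\<close> does not constrain them either).
\<close>

locale lie_algebra = module R L
  for R :: "('r, 'm) ring_scheme" (structure)
    and L :: "('r, 'l, 'n) module_scheme" (structure)
    and bracket :: "'l \<Rightarrow> 'l \<Rightarrow> 'l" +
  assumes bracket_closed:
      "\<lbrakk>x \<in> carrier L; y \<in> carrier L\<rbrakk> \<Longrightarrow> bracket x y \<in> carrier L"
    and bracket_add_left:
      "\<lbrakk>x \<in> carrier L; y \<in> carrier L; z \<in> carrier L\<rbrakk> \<Longrightarrow>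
        bracket (x \<oplus>\<^bsub>L\<^esub> y) z = bracket x z \<oplus>\<^bsub>L\<^esub> bracket y z"
    and bracket_add_right:
      "\<lbrakk>x \<in> carrier L; y \<in> carrier L; z \<in> carrier L\<rbrakk> \<Longrightarrow>
        bracket x (y \<oplus>\<^bsub>L\<^esub> z) = bracket x y \<oplus>\<^bsub>L\<^esub> bracket x z"
    and bracket_smult_left:
      "\<lbrakk>a \<in> carrier R; x \<in> carrier L; y \<in> carrier L\<rbrakk> \<Longrightarrow>
        bracket (a \<odot>\<^bsub>L\<^esub> x) y = a \<odot>\<^bsub>L\<^esub> bracket x y"
    and bracket_smult_right:
      "\<lbrakk>a \<in> carrier R; x \<in> carrier L; y \<in> carrier L\<rbrakk> \<Longrightarrow>
        bracket x (a \<odot>\<^bsub>L\<^esub> y) = a \<odot>\<^bsub>L\<^esub> bracket x y"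
    and bracket_self:
      "x \<in> carrier L \<Longrightarrow> bracket x x = \<zero>\<^bsub>L\<^esub>"
    and jacobi:
      "\<lbrakk>x \<in> carrier L; y \<in> carrier L; z \<in> carrier L\<rbrakk> \<Longrightarrow>
        bracket x (bracket y z) \<oplus>\<^bsub>L\<^esub> bracket y (bracket z x) \<oplus>\<^bsub>L\<^esub> bracket z (bracket x y)
          = \<zero>\<^bsub>L\<^esub>"

text \<open>One-sided absorption suffices because the bracket is skew-symmetric.\<close>

definition lie_ideal ::
  "('r, 'm) ring_scheme \<Rightarrow> ('r, 'l, 'n) module_scheme \<Rightarrow> ('l \<Rightarrow> 'l \<Rightarrow> 'l) \<Rightarrow> 'l set \<Rightarrow> bool"
  where "lie_ideal R L bracket I \<longleftrightarrow>
    submodule I R L \<and> (\<forall>x \<in> carrier L. \<forall>y \<in> I. bracket x y \<in> I)"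

definition generated_lie_ideal ::
  "('r, 'm) ring_scheme \<Rightarrow> ('r, 'l, 'n) module_scheme \<Rightarrow> ('l \<Rightarrow> 'l \<Rightarrow> 'l) \<Rightarrow> 'l set \<Rightarrow> 'l set"
  where "generated_lie_ideal R L bracket S = \<Inter> {I. lie_ideal R L bracket I \<and> S \<subseteq> I}"

definition bracket_zero ::
  "('r, 'l, 'n) module_scheme \<Rightarrow> ('l \<Rightarrow> 'l \<Rightarrow> 'l) \<Rightarrow> 'l set \<Rightarrow> 'l set \<Rightarrow> bool"
  where "bracket_zero L bracket I J \<longleftrightarrow> (\<forall>x \<in> I. \<forall>y \<in> J. bracket x y = \<zero>\<^bsub>L\<^esub>)"

text \<open>
  \<open>decomposition L K A x a\<close>: the family \<open>a\<close>, with \<open>a k \<in> A k\<close> for \<open>k \<in> K\<close>, has finite support and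
  sums to \<open>x\<close>. Families are extensional, so that uniqueness refers to their values on \<open>K\<close> only;
  the sum runs over the support because \<open>finsum\<close> over an infinite set is zero by convention.
\<close>

definition decomposition ::
  "('r, 'l, 'n) module_scheme \<Rightarrow> 'k set \<Rightarrow> ('k \<Rightarrow> 'l set) \<Rightarrow> 'l \<Rightarrow> ('k \<Rightarrow> 'l) \<Rightarrow> bool"
  where "decomposition L K A x a \<longleftrightarrow>
    a \<in> (\<Pi>\<^sub>E k\<in>K. A k) \<and> finite {k \<in> K. a k \<noteq> \<zero>\<^bsub>L\<^esub>} \<and>
    x = finsum L a {k \<in> K. a k \<noteq> \<zero>\<^bsub>L\<^esub>}"

definition internal_direct_sum ::
  "('r, 'l, 'n) module_scheme \<Rightarrow> 'k set \<Rightarrow> ('k \<Rightarrow> 'l set) \<Rightarrow> 'l set \<Rightarrow> bool"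
  where "internal_direct_sum L K A N \<longleftrightarrow>
    N = {x. \<exists>a. decomposition L K A x a} \<and> (\<forall>x \<in> N. \<exists>!a. decomposition L K A x a)"

locale graded_lie_algebra = lie_algebra R L bracket + G: group G
  for R :: "('r, 'm) ring_scheme" (structure)
    and L :: "('r, 'l, 'n) module_scheme" (structure)
    and bracket :: "'l \<Rightarrow> 'l \<Rightarrow> 'l"
    and G :: "('g, 'k) monoid_scheme" (structure)
    and A :: "'g \<Rightarrow> 'l set" +
  assumes component_submodule: "g \<in> carrier G \<Longrightarrow> submodule (A g) R L"
    and direct_sum: "internal_direct_sum L (carrier G) A (carrier L)"
    and bracket_graded:
      "\<lbrakk>g \<in> carrier G; h \<in> carrier G; x \<in> A g; y \<in> A h\<rbrakk> \<Longrightarrow>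
        bracket x y \<in> A (g \<otimes>\<^bsub>G\<^esub> h)"

definition homogeneous_component ::
  "('r, 'l, 'n) module_scheme \<Rightarrow> ('g, 'k) monoid_scheme \<Rightarrow> ('g \<Rightarrow> 'l set) \<Rightarrow> 'l \<Rightarrow> 'g \<Rightarrow> 'l"
  where "homogeneous_component L G A x = (THE a. decomposition L (carrier G) A x a)"

definition element_support ::
  "('r, 'l, 'n) module_scheme \<Rightarrow> ('g, 'k) monoid_scheme \<Rightarrow> ('g \<Rightarrow> 'l set) \<Rightarrow> 'l \<Rightarrow> 'g set"
  where "element_support L G A x =
    {g \<in> carrier G. homogeneous_component L G A x g \<noteq> \<zero>\<^bsub>L\<^esub>}"

definition algebra_support ::
  "('r, 'l, 'n) module_scheme \<Rightarrow> ('g, 'k) monoid_scheme \<Rightarrow> ('g \<Rightarrow> 'l set) \<Rightarrow> 'g set"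
  where "algebra_support L G A = (\<Union>x \<in> carrier L. element_support L G A x)"

definition graded_lie_ideal ::
  "('r, 'm) ring_scheme \<Rightarrow> ('r, 'l, 'n) module_scheme \<Rightarrow> ('l \<Rightarrow> 'l \<Rightarrow> 'l) \<Rightarrow>
    ('g, 'k) monoid_scheme \<Rightarrow> ('g \<Rightarrow> 'l set) \<Rightarrow> 'l set \<Rightarrow> bool"
  where "graded_lie_ideal R L bracket G A I \<longleftrightarrow>
    lie_ideal R L bracket I \<and> internal_direct_sum L (carrier G) (\<lambda>g. I \<inter> A g) I"

definition graded_prime ::
  "('r, 'm) ring_scheme \<Rightarrow> ('r, 'l, 'n) module_scheme \<Rightarrow> ('l \<Rightarrow> 'l \<Rightarrow> 'l) \<Rightarrow>
    ('g, 'k) monoid_scheme \<Rightarrow> ('g \<Rightarrow> 'l set) \<Rightarrow> bool"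
  where "graded_prime R L bracket G A \<longleftrightarrow>
    \<not> (\<exists>I J. graded_lie_ideal R L bracket G A I \<and> graded_lie_ideal R L bracket G A J \<and>
        I \<noteq> {\<zero>\<^bsub>L\<^esub>} \<and> J \<noteq> {\<zero>\<^bsub>L\<^esub>} \<and> bracket_zero L bracket I J)"

end

theory Submission
  imports Defs
begin

text \<open>
  If \<open>gg' \<noteq> g'g\<close>, then \<open>[L\<^sub>g, L\<^sub>g\<^sub>']\<close> lies in distinct components \<open>L\<^sub>g\<^sub>g\<^sub>'\<close> and \<open>L\<^sub>g\<^sub>'\<^sub>g\<close>, so it is zero.
  For fixed \<open>g\<close>, let \<open>N\<close> be the set of all \<open>u\<close> with \<open>[u, L\<^sub>h] = 0\<close> for every \<open>h\<close> that does not commute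
  with \<open>g\<close>. Then \<open>N\<close> contains \<open>L\<^sub>g\<close>, and it is an ideal: let \<open>u \<in> N\<close>, \<open>x \<in> L\<^sub>k\<close> and \<open>b \<in> L\<^sub>h\<close>. If \<open>k\<close> does
  not commute with \<open>g\<close>, then \<open>[x, u] = 0\<close>. Otherwise \<open>kh\<close> does not commute with \<open>g\<close> either, and
  \<open>[[x, u], b] = [x, [u, b]] - [u, [x, b]] = 0\<close>. Hence the ideal generated by \<open>L\<^sub>g\<close> annihilates
  \<open>L\<^sub>g\<^sub>'\<close>, and therefore the ideal generated by \<open>L\<^sub>g\<^sub>'\<close>, since the centralizer of an ideal is an ideal.
\<close>

section \<open>Generated ideals and decompositions over families of subsets\<close>

lemma generated_lie_ideal_least:
  "\<lbrakk>lie_ideal R L bracket I; S \<subseteq> I\<rbrakk> \<Longrightarrow> generated_lie_ideal R L bracket S \<subseteq> I"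
  unfolding generated_lie_ideal_def by blast

lemma generated_lie_ideal_incl: "S \<subseteq> generated_lie_ideal R L bracket S"
  unfolding generated_lie_ideal_def by blast

lemma (in module) submodule_zero_closed: "submodule N R M \<Longrightarrow> \<zero>\<^bsub>M\<^esub> \<in> N"
  using subgroup.one_closed[OF submodule.axioms(1)] by force

lemma decomposition_mono:
  assumes "decomposition L K B x a" "\<And>k. k \<in> K \<Longrightarrow> B k \<subseteq> C k"
  shows "decomposition L K C x a"
  using assms unfolding decomposition_def PiE_def Pi_def by blast

context module
begin

text \<open>A decomposition writes \<open>x\<close> as a finite sum of members of the
  \<open>B k\<close>, so induction on that sum applies. With \<open>N\<close> of the form
  \<open>{x \<in> carrier M. P x}\<close>, this reduces an additive property \<open>P\<close> to
  homogeneous elements.\<close>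

lemma decomposition_induct:
  assumes dec: "decomposition M K B x a"
    and B: "\<And>k. k \<in> K \<Longrightarrow> B k \<subseteq> N"
    and N: "N \<subseteq> carrier M" "\<zero>\<^bsub>M\<^esub> \<in> N" "\<And>x y. \<lbrakk>x \<in> N; y \<in> N\<rbrakk> \<Longrightarrow> x \<oplus>\<^bsub>M\<^esub> y \<in> N"
  shows "x \<in> N"
proof -
  \<comment> \<open>The support is fixed by \<open>a\<close>, so the induction runs over arbitrary
    finite subsets of \<open>K\<close>.\<close>
  have "finsum M a F \<in> N" if "finite F" "F \<subseteq> K" for F
    using that
  proof (induction F)
    case empty
    then show ?case using N by simp
  next
    case (insert k F)
    have a: "a j \<in> N" if "j \<in> K" for j
      using dec B that unfolding decomposition_def by (blast dest: PiE_mem)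
    have "a j \<in> carrier M" if "j \<in> K" for j using a[OF that] N(1) by blast
    then have "finsum M a (insert k F) = a k \<oplus>\<^bsub>M\<^esub> finsum M a F"
      using insert by (intro M.finsum_insert) auto
    then show ?case using insert a N by auto
  qed
  then show ?thesis using dec unfolding decomposition_def by auto
qed

lemma decomposition_single:
  assumes k: "k \<in> K" and x: "x \<in> B k" "x \<in> carrier M" and B: "\<And>k. k \<in> K \<Longrightarrow> \<zero>\<^bsub>M\<^esub> \<in> B k"
  shows "\<exists>a. decomposition M K B x a"
proof
  let ?a = "\<lambda>j\<in>K. if j = k then x else \<zero>\<^bsub>M\<^esub>"
  \<comment> \<open>For \<open>x\<close> equal to zero the support is empty rather than
    \<open>{k}\<close>; the sum is zero in that case as well.\<close>
  have supp: "{j \<in> K. ?a j \<noteq> \<zero>\<^bsub>M\<^esub>} = (if x = \<zero>\<^bsub>M\<^esub> then {} else {k})" using k by auto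
  have "finsum M ?a {k} = x" using k x by (simp add: M.finsum_insert)
  then have "x = finsum M ?a {j \<in> K. ?a j \<noteq> \<zero>\<^bsub>M\<^esub>}" unfolding supp by simp
  moreover have "finite {j \<in> K. ?a j \<noteq> \<zero>\<^bsub>M\<^esub>}" unfolding supp by simp
  moreover have "?a \<in> (\<Pi>\<^sub>E k\<in>K. B k)" using k x B by auto
  ultimately show "decomposition M K B x ?a" unfolding decomposition_def by blast
qed

text \<open>Indices outside the support contribute zero. This lets two decompositions with different
  supports be summed over a common finite index set.\<close>

lemma decomposition_finsum_superset:
  assumes dec: "decomposition M K B x a" and B: "\<And>k. k \<in> K \<Longrightarrow> B k \<subseteq> carrier M"
    and F: "finite F" "F \<subseteq> K" "{k \<in> K. a k \<noteq> \<zero>\<^bsub>M\<^esub>} \<subseteq> F"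
  shows "x = finsum M a F"
proof -
  have "a \<in> F \<rightarrow> carrier M"
    using dec B F unfolding decomposition_def by (blast dest: PiE_mem)
  then have "finsum M a {k \<in> K. a k \<noteq> \<zero>\<^bsub>M\<^esub>} = finsum M a F"
    using F by (intro M.add.finprod_mono_neutral_cong_left) auto
  then show ?thesis using dec unfolding decomposition_def by simp
qed

lemma decomposition_add:
  assumes x: "decomposition M K B x a" and y: "decomposition M K B y b"
    and B: "\<And>k. k \<in> K \<Longrightarrow> B k \<subseteq> carrier M"
    and add: "\<And>k u v. \<lbrakk>k \<in> K; u \<in> B k; v \<in> B k\<rbrakk> \<Longrightarrow> u \<oplus>\<^bsub>M\<^esub> v \<in> B k"
  shows "decomposition M K B (x \<oplus>\<^bsub>M\<^esub> y) (\<lambda>k\<in>K. a k \<oplus>\<^bsub>M\<^esub> b k)"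
proof -
  let ?c = "\<lambda>k\<in>K. a k \<oplus>\<^bsub>M\<^esub> b k"
  let ?F = "{k \<in> K. a k \<noteq> \<zero>\<^bsub>M\<^esub>} \<union> {k \<in> K. b k \<noteq> \<zero>\<^bsub>M\<^esub>}"
  have F: "finite ?F" "?F \<subseteq> K" using x y unfolding decomposition_def by auto
  have mem: "a k \<in> B k" "b k \<in> B k" if "k \<in> K" for k
    using x y that unfolding decomposition_def by (blast dest: PiE_mem)+
  have carr: "a k \<in> carrier M" "b k \<in> carrier M" if "k \<in> K" for k
    using mem[OF that] B[OF that] by auto
  \<comment> \<open>Terms may cancel, so the support of the sum can be smaller than
    \<open>?F\<close>. Inclusion suffices, since the extra summands are zero.\<close>
  have supp: "{k \<in> K. ?c k \<noteq> \<zero>\<^bsub>M\<^esub>} \<subseteq> ?F" by auto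
  have "x \<oplus>\<^bsub>M\<^esub> y = finsum M a ?F \<oplus>\<^bsub>M\<^esub> finsum M b ?F"
    using decomposition_finsum_superset[OF x B F] decomposition_finsum_superset[OF y B F] by auto
  also have "\<dots> = finsum M (\<lambda>k. a k \<oplus>\<^bsub>M\<^esub> b k) ?F" using carr by (intro M.finsum_addf[symmetric]) auto
  also have "\<dots> = finsum M ?c ?F" using carr by (intro M.finsum_cong') auto
  also have "\<dots> = finsum M ?c {k \<in> K. ?c k \<noteq> \<zero>\<^bsub>M\<^esub>}"
    using F supp carr by (intro M.add.finprod_mono_neutral_cong_left[symmetric]) auto
  finally have "x \<oplus>\<^bsub>M\<^esub> y = finsum M ?c {k \<in> K. ?c k \<noteq> \<zero>\<^bsub>M\<^esub>}" .
  moreover have "finite {k \<in> K. ?c k \<noteq> \<zero>\<^bsub>M\<^esub>}" using F supp by (meson finite_subset)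
  moreover have "?c \<in> (\<Pi>\<^sub>E k\<in>K. B k)" using mem add by auto
  ultimately show ?thesis unfolding decomposition_def by blast
qed

end

lemma (in module) decomposition_smult:
  assumes x: "decomposition M K B x a" and r: "r \<in> carrier R"
    and B: "\<And>k. k \<in> K \<Longrightarrow> submodule (B k) R M"
  shows "decomposition M K B (r \<odot>\<^bsub>M\<^esub> x) (\<lambda>k\<in>K. r \<odot>\<^bsub>M\<^esub> a k)"
proof -
  let ?c = "\<lambda>k\<in>K. r \<odot>\<^bsub>M\<^esub> a k"
  let ?F = "{k \<in> K. a k \<noteq> \<zero>\<^bsub>M\<^esub>}"
  have F: "finite ?F" using x unfolding decomposition_def by auto
  have mem: "a k \<in> B k" if "k \<in> K" for k
    using x that unfolding decomposition_def by (blast dest: PiE_mem)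
  have carr: "a k \<in> carrier M" if "k \<in> K" for k
    using mem[OF that] submoduleE(1)[OF B[OF that]] by blast
  \<comment> \<open>A nonzero \<open>a k\<close> may be killed by \<open>r\<close>, so again only an
    inclusion of supports holds.\<close>
  have supp: "{k \<in> K. ?c k \<noteq> \<zero>\<^bsub>M\<^esub>} \<subseteq> ?F" using r by auto
  have "r \<odot>\<^bsub>M\<^esub> x = r \<odot>\<^bsub>M\<^esub> finsum M a ?F" using x unfolding decomposition_def by simp
  also have "\<dots> = finsum M (\<lambda>k. r \<odot>\<^bsub>M\<^esub> a k) ?F" using carr by (intro finsum_smult_ldistr F r) auto
  also have "\<dots> = finsum M ?c ?F" using carr r by (intro M.finsum_cong') auto
  also have "\<dots> = finsum M ?c {k \<in> K. ?c k \<noteq> \<zero>\<^bsub>M\<^esub>}"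
    using F supp carr r by (intro M.add.finprod_mono_neutral_cong_left[symmetric]) auto
  finally have "r \<odot>\<^bsub>M\<^esub> x = finsum M ?c {k \<in> K. ?c k \<noteq> \<zero>\<^bsub>M\<^esub>}" .
  moreover have "finite {k \<in> K. ?c k \<noteq> \<zero>\<^bsub>M\<^esub>}" using F supp by (meson finite_subset)
  moreover have "?c \<in> (\<Pi>\<^sub>E k\<in>K. B k)" using mem submoduleE(4)[OF B] r by auto
  ultimately show ?thesis unfolding decomposition_def by blast
qed

section \<open>Bracket identities, ideals and centralizers\<close>

context lie_algebra
begin

lemma bracket_zero_left: "x \<in> carrier L \<Longrightarrow> bracket \<zero>\<^bsub>L\<^esub> x = \<zero>\<^bsub>L\<^esub>"
  using bracket_smult_left[of "\<zero>" "\<zero>\<^bsub>L\<^esub>" x] bracket_closed by simp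

lemma bracket_zero_right: "x \<in> carrier L \<Longrightarrow> bracket x \<zero>\<^bsub>L\<^esub> = \<zero>\<^bsub>L\<^esub>"
  using bracket_smult_right[of "\<zero>" x "\<zero>\<^bsub>L\<^esub>"] bracket_closed by simp

lemma bracket_skew:
  assumes [simp]: "x \<in> carrier L" "y \<in> carrier L"
  shows "bracket x y = \<ominus>\<^bsub>L\<^esub> bracket y x"
proof -
  have "\<zero>\<^bsub>L\<^esub> = bracket (x \<oplus>\<^bsub>L\<^esub> y) (x \<oplus>\<^bsub>L\<^esub> y)" by (simp add: bracket_self)
  also have "\<dots> = bracket x y \<oplus>\<^bsub>L\<^esub> bracket y x"
    by (simp add: bracket_add_left bracket_add_right bracket_self[of x] bracket_self[of y] bracket_closed M.a_comm)
  finally show ?thesis by (simp add: bracket_closed M.minus_equality)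
qed

lemma bracket_eq_zero_commute:
  "\<lbrakk>x \<in> carrier L; y \<in> carrier L; bracket x y = \<zero>\<^bsub>L\<^esub>\<rbrakk> \<Longrightarrow> bracket y x = \<zero>\<^bsub>L\<^esub>"
  using bracket_skew[of y x] by simp

text \<open>By the Jacobi identity [[x, u], b] = [x, [u, b]] - [u, [x, b]], and both terms on the
  right vanish. Closure under brackets of every annihilator below rests on this.\<close>

lemma bracket_bracket_eq_zero:
  assumes "x \<in> carrier L" "u \<in> carrier L" "b \<in> carrier L"
    and "bracket u b = \<zero>\<^bsub>L\<^esub>" "bracket u (bracket x b) = \<zero>\<^bsub>L\<^esub>"
  shows "bracket (bracket x u) b = \<zero>\<^bsub>L\<^esub>"
proof -
  \<comment> \<open>The cyclic form of Jacobi contains [b, x] instead of [x, b]; the sign is moved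
    out of the bracket as the scalar \<open>\<ominus> \<one>\<close>.\<close>
  have "bracket u (bracket b x) = \<zero>\<^bsub>L\<^esub>"
    using assms bracket_skew[of b x] bracket_smult_right[of "\<ominus> \<one>" u "bracket x b"]
    by (simp add: bracket_closed smult_l_minus)
  then have "bracket b (bracket x u) = \<zero>\<^bsub>L\<^esub>"
    using jacobi[of x u b] assms by (simp add: bracket_zero_right bracket_closed)
  then show ?thesis using assms by (intro bracket_eq_zero_commute[of b "bracket x u"]) (auto intro: bracket_closed)
qed

text \<open>Closure under negation comes from scalar multiplication by
  \<open>\<ominus> \<one>\<close>.\<close>

lemma lie_idealI:
  assumes "I \<subseteq> carrier L" "\<zero>\<^bsub>L\<^esub> \<in> I"
    and "\<And>x y. \<lbrakk>x \<in> I; y \<in> I\<rbrakk> \<Longrightarrow> x \<oplus>\<^bsub>L\<^esub> y \<in> I"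
    and smult: "\<And>r x. \<lbrakk>r \<in> carrier R; x \<in> I\<rbrakk> \<Longrightarrow> r \<odot>\<^bsub>L\<^esub> x \<in> I"
    and "\<And>x y. \<lbrakk>x \<in> carrier L; y \<in> I\<rbrakk> \<Longrightarrow> bracket x y \<in> I"
  shows "lie_ideal R L bracket I"
proof -
  have "\<ominus>\<^bsub>L\<^esub> x \<in> I" if "x \<in> I" for x
  proof -
    have "(\<ominus> \<one>) \<odot>\<^bsub>L\<^esub> x = \<ominus>\<^bsub>L\<^esub> x" using assms(1) that by (auto simp: smult_l_minus)
    then show ?thesis using smult[of "\<ominus> \<one>" x] that by simp
  qed
  then show ?thesis unfolding lie_ideal_def using assms by (auto intro!: submoduleI)
qed

lemma
  assumes "lie_ideal R L bracket I"
  shows lie_ideal_subset: "I \<subseteq> carrier L"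
    and lie_ideal_zero: "\<zero>\<^bsub>L\<^esub> \<in> I"
    and lie_ideal_add: "\<And>x y. \<lbrakk>x \<in> I; y \<in> I\<rbrakk> \<Longrightarrow> x \<oplus>\<^bsub>L\<^esub> y \<in> I"
    and lie_ideal_smult: "\<And>r x. \<lbrakk>r \<in> carrier R; x \<in> I\<rbrakk> \<Longrightarrow> r \<odot>\<^bsub>L\<^esub> x \<in> I"
    and lie_ideal_bracket: "\<And>x y. \<lbrakk>x \<in> carrier L; y \<in> I\<rbrakk> \<Longrightarrow> bracket x y \<in> I"
proof -
  have sub: "submodule I R L" using assms unfolding lie_ideal_def by blast
  show "I \<subseteq> carrier L" by (rule submoduleE(1)[OF sub])
  show "\<zero>\<^bsub>L\<^esub> \<in> I" by (rule submodule_zero_closed[OF sub])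
  show "x \<oplus>\<^bsub>L\<^esub> y \<in> I" if "x \<in> I" "y \<in> I" for x y by (rule submoduleE(5)[OF sub that])
  show "r \<odot>\<^bsub>L\<^esub> x \<in> I" if "r \<in> carrier R" "x \<in> I" for r x by (rule submoduleE(4)[OF sub that])
  show "bracket x y \<in> I" if "x \<in> carrier L" "y \<in> I" for x y
    using assms that unfolding lie_ideal_def by blast
qed

lemma lie_ideal_carrier: "lie_ideal R L bracket (carrier L)"
  by (rule lie_idealI) (auto intro: bracket_closed)

text \<open>The closure conditions pass to intersections. Containment in the carrier holds because
  \<open>carrier L\<close> is itself one of the ideals intersected.\<close>

lemma lie_ideal_generated:
  assumes "S \<subseteq> carrier L"
  shows "lie_ideal R L bracket (generated_lie_ideal R L bracket S)"
proof (rule lie_idealI)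
  show "generated_lie_ideal R L bracket S \<subseteq> carrier L"
    using generated_lie_ideal_least[OF lie_ideal_carrier assms] .
qed (unfold generated_lie_ideal_def,
    (blast intro: lie_ideal_zero lie_ideal_add lie_ideal_smult lie_ideal_bracket)+)

text \<open>If \<open>y\<close> centralizes \<open>I\<close> and \<open>b \<in> I\<close>, then
  [x, b] is again in \<open>I\<close>, so [y, b] and [y, [x, b]] both vanish and
  \<open>bracket_bracket_eq_zero\<close> applies.\<close>

lemma lie_ideal_centralizer:
  assumes I: "lie_ideal R L bracket I"
  shows "lie_ideal R L bracket {y \<in> carrier L. \<forall>x \<in> I. bracket y x = \<zero>\<^bsub>L\<^esub>}"
proof -
  have [simp]: "x \<in> carrier L" if "x \<in> I" for x using lie_ideal_subset[OF I] that by auto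
  show ?thesis
  proof (rule lie_idealI, goal_cases)
    case (5 x y)
    then have "bracket (bracket x y) b = \<zero>\<^bsub>L\<^esub>" if "b \<in> I" for b
      using that lie_ideal_bracket[OF I, of x b] by (intro bracket_bracket_eq_zero) auto
    then show ?case using 5 bracket_closed by blast
  qed (auto simp: bracket_zero_left bracket_add_left bracket_smult_left)
qed

end

section \<open>Components of noncommuting degrees\<close>

context graded_lie_algebra
begin

lemma component_closed: "\<lbrakk>g \<in> carrier G; x \<in> A g\<rbrakk> \<Longrightarrow> x \<in> carrier L"
  using submoduleE(1)[OF component_submodule] by blast

lemma decomposition_unique:
  assumes "decomposition L (carrier G) A x a" "decomposition L (carrier G) A x b"
  shows "a = b"
  using assms direct_sum unfolding internal_direct_sum_def by blast

lemma decomposition_exists: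
  assumes "x \<in> carrier L"
  obtains a where "decomposition L (carrier G) A x a"
  using assms direct_sum unfolding internal_direct_sum_def by blast

text \<open>A nonzero common element would have two decompositions, one concentrated at
  \<open>g\<close> and one at \<open>h\<close>, against uniqueness.\<close>

lemma components_disjoint:
  assumes g: "g \<in> carrier G" and h: "h \<in> carrier G" and "g \<noteq> h"
    and x: "x \<in> A g" "x \<in> A h"
  shows "x = \<zero>\<^bsub>L\<^esub>"
proof (rule ccontr)
  assume nz: "x \<noteq> \<zero>\<^bsub>L\<^esub>"
  have xc: "x \<in> carrier L" using component_closed g x by blast
  have dec: "decomposition L (carrier G) A x (\<lambda>j\<in>carrier G. if j = k then x else \<zero>\<^bsub>L\<^esub>)"
    if k: "k \<in> carrier G" "x \<in> A k" for k
  proof -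
    let ?a = "\<lambda>j\<in>carrier G. if j = k then x else \<zero>\<^bsub>L\<^esub>"
    have "{j \<in> carrier G. ?a j \<noteq> \<zero>\<^bsub>L\<^esub>} = {k}" using k nz by auto
    moreover have "finsum L ?a {k} = x" using k xc by (simp add: M.finsum_insert)
    moreover have "?a \<in> (\<Pi>\<^sub>E k\<in>carrier G. A k)"
      using k submodule_zero_closed[OF component_submodule] by auto
    ultimately show ?thesis unfolding decomposition_def by simp
  qed
  \<comment> \<open>Evaluated at \<open>g\<close>, the first decomposition gives \<open>x\<close>
    and the second gives zero.\<close>
  show False
    using fun_cong[OF decomposition_unique[OF dec[OF g x(1)] dec[OF h x(2)]], of g] g nz \<open>g \<noteq> h\<close>
    by simp
qed

lemma bracket_noncommuting_components:
  assumes "g \<in> carrier G" "h \<in> carrier G" "g \<otimes>\<^bsub>G\<^esub> h \<noteq> h \<otimes>\<^bsub>G\<^esub> g" "a \<in> A g" "b \<in> A h"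
  shows "bracket a b = \<zero>\<^bsub>L\<^esub>"
proof -
  have c: "a \<in> carrier L" "b \<in> carrier L" using assms component_closed by auto
  have "bracket b a \<in> A (h \<otimes>\<^bsub>G\<^esub> g)" using assms bracket_graded by simp
  \<comment> \<open>[a, b] is the negative of [b, a], and components are closed under
    negation.\<close>
  then have "bracket a b \<in> A (h \<otimes>\<^bsub>G\<^esub> g)"
    using submoduleE(3)[OF component_submodule[of "h \<otimes>\<^bsub>G\<^esub> g"]] bracket_skew[OF c] assms by simp
  moreover have "bracket a b \<in> A (g \<otimes>\<^bsub>G\<^esub> h)" using assms bracket_graded by simp
  ultimately show ?thesis
    using components_disjoint[of "g \<otimes>\<^bsub>G\<^esub> h" "h \<otimes>\<^bsub>G\<^esub> g"] assms by simp
qed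

text \<open>All degrees not commuting with \<open>g\<close> are treated at once: bracketing with a
  homogeneous element moves \<open>b\<close> from degree h to degree kh, so a condition on a single
  \<open>h\<close> would not be preserved.\<close>

lemma lie_ideal_annihilating_noncommuting_components:
  assumes g: "g \<in> carrier G"
  defines "N \<equiv> {u \<in> carrier L.
    \<forall>h \<in> carrier G. g \<otimes>\<^bsub>G\<^esub> h \<noteq> h \<otimes>\<^bsub>G\<^esub> g \<longrightarrow> (\<forall>b \<in> A h. bracket u b = \<zero>\<^bsub>L\<^esub>)}"
  shows "lie_ideal R L bracket N"
proof -
  have homog: "bracket x u \<in> N" if k: "k \<in> carrier G" "x \<in> A k" and u: "u \<in> N" for k x u
  proof -
    have uc: "u \<in> carrier L" and xc: "x \<in> carrier L"
      using u k component_closed unfolding N_def by auto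
    have uN: "bracket u b = \<zero>\<^bsub>L\<^esub>"
      if "h \<in> carrier G" "g \<otimes>\<^bsub>G\<^esub> h \<noteq> h \<otimes>\<^bsub>G\<^esub> g" "b \<in> A h" for h b
      using u that unfolding N_def by blast
    have "bracket (bracket x u) b = \<zero>\<^bsub>L\<^esub>"
      if h: "h \<in> carrier G" "g \<otimes>\<^bsub>G\<^esub> h \<noteq> h \<otimes>\<^bsub>G\<^esub> g" and b: "b \<in> A h" for h b
    proof (cases "g \<otimes>\<^bsub>G\<^esub> k = k \<otimes>\<^bsub>G\<^esub> g")
      case True
      \<comment> \<open>If \<open>g\<close> commuted with kh as well as with \<open>k\<close>,
        cancelling \<open>k\<close> would make it commute with \<open>h\<close>.\<close>
      have "g \<otimes>\<^bsub>G\<^esub> (k \<otimes>\<^bsub>G\<^esub> h) \<noteq> (k \<otimes>\<^bsub>G\<^esub> h) \<otimes>\<^bsub>G\<^esub> g"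
      proof
        assume "g \<otimes>\<^bsub>G\<^esub> (k \<otimes>\<^bsub>G\<^esub> h) = (k \<otimes>\<^bsub>G\<^esub> h) \<otimes>\<^bsub>G\<^esub> g"
        then have "k \<otimes>\<^bsub>G\<^esub> (g \<otimes>\<^bsub>G\<^esub> h) = k \<otimes>\<^bsub>G\<^esub> (h \<otimes>\<^bsub>G\<^esub> g)"
          using True g h k by (metis G.m_assoc)
        then show False using g h k by simp
      qed
      then have "bracket u (bracket x b) = \<zero>\<^bsub>L\<^esub>"
        using uN[of "k \<otimes>\<^bsub>G\<^esub> h"] bracket_graded k h b by simp
      then show ?thesis
        using bracket_bracket_eq_zero[OF xc uc] uN[OF h b] component_closed[OF h(1) b] by simp
    next
      case False
      then have "bracket x u = \<zero>\<^bsub>L\<^esub>" using uN[OF k(1) _ k(2)] bracket_eq_zero_commute[OF uc xc] by simp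
      then show ?thesis using bracket_zero_left component_closed[OF h(1) b] by simp
    qed
    then show ?thesis unfolding N_def using bracket_closed[OF xc uc] by blast
  qed
  have N: "N \<subseteq> carrier L" "\<zero>\<^bsub>L\<^esub> \<in> N" "\<And>x y. \<lbrakk>x \<in> N; y \<in> N\<rbrakk> \<Longrightarrow> x \<oplus>\<^bsub>L\<^esub> y \<in> N"
    unfolding N_def by (auto simp: bracket_zero_left bracket_add_left component_closed)
  show ?thesis
  proof (rule lie_idealI)
    fix x u assume x: "x \<in> carrier L" and u: "u \<in> N"
    have uc: "u \<in> carrier L" using u N by blast
    obtain a where "decomposition L (carrier G) A x a" using decomposition_exists[OF x] .
    \<comment> \<open>Membership of [x, u] in \<open>N\<close> is preserved by sums in
      \<open>x\<close>, so the homogeneous case \<open>homog\<close> suffices.\<close>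
    then have "x \<in> {x \<in> carrier L. bracket x u \<in> N}"
      by (rule decomposition_induct)
        (use homog u uc N in \<open>auto simp: bracket_zero_left bracket_add_left component_closed\<close>)
    then show "bracket x u \<in> N" by blast
  qed (use N in \<open>auto simp: N_def bracket_smult_left component_closed\<close>)
qed

lemma bracket_zero_generated_ideals:
  assumes g: "g \<in> carrier G" and h: "h \<in> carrier G" and ne: "g \<otimes>\<^bsub>G\<^esub> h \<noteq> h \<otimes>\<^bsub>G\<^esub> g"
  shows "bracket_zero L bracket
    (generated_lie_ideal R L bracket (A g)) (generated_lie_ideal R L bracket (A h))"
    (is "bracket_zero L bracket ?I ?J")
proof -
  have I: "lie_ideal R L bracket ?I"
    using lie_ideal_generated component_closed[OF g] by blast
  have Ih: "bracket u b = \<zero>\<^bsub>L\<^esub>" if "u \<in> ?I" "b \<in> A h" for u b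
    using generated_lie_ideal_least[OF lie_ideal_annihilating_noncommuting_components[OF g], of "A g"]
      bracket_noncommuting_components[OF g] component_closed[OF g] that h ne by blast
  have "?J \<subseteq> {y \<in> carrier L. \<forall>x \<in> ?I. bracket y x = \<zero>\<^bsub>L\<^esub>}"
    using lie_ideal_subset[OF I] component_closed[OF h] Ih
    by (intro generated_lie_ideal_least lie_ideal_centralizer I)
      (auto intro: bracket_eq_zero_commute)
  then show ?thesis
    unfolding bracket_zero_def using lie_ideal_subset[OF I] by (blast intro: bracket_eq_zero_commute)
qed

section \<open>Gradedness of the ideal generated by a component\<close>

lemma graded_lie_ideal_generated:
  assumes g: "g \<in> carrier G"
  shows "graded_lie_ideal R L bracket G A (generated_lie_ideal R L bracket (A g))"
proof -
  let ?I = "generated_lie_ideal R L bracket (A g)"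
  let ?B = "\<lambda>k. ?I \<inter> A k"
  \<comment> \<open>\<open>H\<close> consists of the sums of homogeneous elements of
    \<open>?I\<close>. It turns out to be an ideal containing \<open>A g\<close>, so minimality of
    \<open>?I\<close> forces \<open>?I \<subseteq> H\<close>; the reverse inclusion is immediate by
    summation.\<close>
  define H where "H = {x \<in> carrier L. \<exists>a. decomposition L (carrier G) ?B x a}"
  have I: "lie_ideal R L bracket ?I"
    using lie_ideal_generated component_closed[OF g] by blast
  have B: "submodule (?B k) R L" if k: "k \<in> carrier G" for k
    using I component_submodule[OF k] lie_ideal_subset[OF I] submodule_zero_closed
    unfolding lie_ideal_def by (intro submoduleI) (auto intro: submoduleE)
  have BL: "?B k \<subseteq> carrier L" and B0: "\<zero>\<^bsub>L\<^esub> \<in> ?B k" if "k \<in> carrier G" for k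
    using submoduleE(1)[OF B[OF that]] submodule_zero_closed[OF B[OF that]] by auto
  have single: "?B k \<subseteq> H" if k: "k \<in> carrier G" for k
  proof
    fix x assume x: "x \<in> ?B k"
    have "\<exists>a. decomposition L (carrier G) ?B x a"
      by (rule decomposition_single[OF k]) (use x BL[OF k] B0 in auto)
    then show "x \<in> H" unfolding H_def using x BL[OF k] by blast
  qed
  have HL: "H \<subseteq> carrier L" and H0: "\<zero>\<^bsub>L\<^esub> \<in> H"
    using single[OF g] B0[OF g] unfolding H_def by auto
  have Hadd: "x \<oplus>\<^bsub>L\<^esub> y \<in> H" if "x \<in> H" "y \<in> H" for x y
  proof -
    obtain a b where "decomposition L (carrier G) ?B x a" "decomposition L (carrier G) ?B y b"
      using \<open>x \<in> H\<close> \<open>y \<in> H\<close> unfolding H_def by blast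
    then have "decomposition L (carrier G) ?B (x \<oplus>\<^bsub>L\<^esub> y) (\<lambda>k\<in>carrier G. a k \<oplus>\<^bsub>L\<^esub> b k)"
      by (rule decomposition_add) (fact BL submoduleE(5)[OF B])+
    then show ?thesis using that unfolding H_def by blast
  qed
  have homog: "bracket y x \<in> H" if h: "h \<in> carrier G" "y \<in> A h" and x: "x \<in> H" for h x y
  proof -
    have y: "y \<in> carrier L" using component_closed h by blast
    obtain a where "decomposition L (carrier G) ?B x a" using x unfolding H_def by blast
    then have "x \<in> {x \<in> carrier L. bracket y x \<in> H}"
    proof (rule decomposition_induct)
      fix k assume k: "k \<in> carrier G"
      \<comment> \<open>Bracketing with \<open>y\<close> of degree \<open>h\<close> keeps elements
        in \<open>?I\<close> and moves degree k to degree hk, so the result lies in a single piece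
        of the family \<open>?B\<close>.\<close>
      show "?B k \<subseteq> {x \<in> carrier L. bracket y x \<in> H}"
        using BL[OF k] single[of "h \<otimes>\<^bsub>G\<^esub> k"] k h y lie_ideal_bracket[OF I] bracket_graded by blast
    qed (use y H0 Hadd in \<open>auto simp: bracket_zero_right bracket_add_right\<close>)
    then show ?thesis by blast
  qed
  have "lie_ideal R L bracket H"
  proof (rule lie_idealI[OF HL H0 Hadd])
    fix r x assume r: "r \<in> carrier R" and x: "x \<in> H"
    obtain a where "decomposition L (carrier G) ?B x a" using x unfolding H_def by blast
    then have "decomposition L (carrier G) ?B (r \<odot>\<^bsub>L\<^esub> x) (\<lambda>k\<in>carrier G. r \<odot>\<^bsub>L\<^esub> a k)"
      using r B by (rule decomposition_smult)
    then show "r \<odot>\<^bsub>L\<^esub> x \<in> H" using r x unfolding H_def by blast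
  next
    fix x u assume x: "x \<in> carrier L" and u: "u \<in> H"
    have uc: "u \<in> carrier L" using u HL by blast
    obtain a where "decomposition L (carrier G) A x a" using decomposition_exists[OF x] .
    then have "x \<in> {x \<in> carrier L. bracket x u \<in> H}"
      by (rule decomposition_induct)
        (use homog u uc H0 Hadd in \<open>auto simp: bracket_zero_left bracket_add_left component_closed\<close>)
    then show "bracket x u \<in> H" by blast
  qed
  moreover have "A g \<subseteq> H"
    using single[OF g] generated_lie_ideal_incl[of "A g" R L bracket] by blast
  ultimately have "?I \<subseteq> H" by (rule generated_lie_ideal_least)
  moreover have "x \<in> ?I" if "decomposition L (carrier G) ?B x a" for x a
    using that by (rule decomposition_induct)
      (auto intro: lie_ideal_zero[OF I] lie_ideal_add[OF I] dest: subsetD[OF lie_ideal_subset[OF I]])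
  ultimately have "?I = {x. \<exists>a. decomposition L (carrier G) ?B x a}"
    unfolding H_def by blast
  \<comment> \<open>A decomposition into the smaller sets \<open>?B k\<close> is also one into the
    \<open>A k\<close>, so uniqueness is inherited from \<open>L\<close>.\<close>
  moreover have "a = b"
    if "decomposition L (carrier G) ?B x a" "decomposition L (carrier G) ?B x b" for x a b
    using decomposition_unique that decomposition_mono[of L "carrier G" ?B x _ A] by blast
  ultimately have "internal_direct_sum L (carrier G) ?B ?I"
    unfolding internal_direct_sum_def by blast
  then show ?thesis unfolding graded_lie_ideal_def using I by blast
qed

section \<open>Support and graded primeness\<close>

lemma algebra_support_nonzero_component:
  assumes "g \<in> algebra_support L G A"
  shows "g \<in> carrier G" "\<not> A g \<subseteq> {\<zero>\<^bsub>L\<^esub>}"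
proof -
  obtain x where x: "x \<in> carrier L" and g: "g \<in> carrier G"
    and nz: "homogeneous_component L G A x g \<noteq> \<zero>\<^bsub>L\<^esub>"
    using assms unfolding algebra_support_def element_support_def by blast
  obtain a where a: "decomposition L (carrier G) A x a" using decomposition_exists[OF x] .
  \<comment> \<open>Existence and uniqueness of the decomposition give the \<open>THE\<close> its
    intended value.\<close>
  have "homogeneous_component L G A x = a"
    unfolding homogeneous_component_def using a decomposition_unique by blast
  then have "a g \<noteq> \<zero>\<^bsub>L\<^esub>" "a g \<in> A g"
    using nz a g unfolding decomposition_def by (auto dest: PiE_mem)
  then show "g \<in> carrier G" "\<not> A g \<subseteq> {\<zero>\<^bsub>L\<^esub>}" using g by auto
qed

text \<open>Otherwise the ideals generated by \<open>A g\<close> and \<open>A h\<close> would be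
  nonzero, graded and mutually annihilating, which graded primeness forbids.\<close>

lemma graded_prime_support_commutes:
  assumes prime: "graded_prime R L bracket G A"
    and g: "g \<in> algebra_support L G A" and h: "h \<in> algebra_support L G A"
  shows "g \<otimes>\<^bsub>G\<^esub> h = h \<otimes>\<^bsub>G\<^esub> g"
proof (rule ccontr)
  assume ne: "g \<otimes>\<^bsub>G\<^esub> h \<noteq> h \<otimes>\<^bsub>G\<^esub> g"
  note g = algebra_support_nonzero_component[OF g]
    and h = algebra_support_nonzero_component[OF h]
  have "generated_lie_ideal R L bracket (A k) \<noteq> {\<zero>\<^bsub>L\<^esub>}" if "\<not> A k \<subseteq> {\<zero>\<^bsub>L\<^esub>}" for k
    using that generated_lie_ideal_incl[of "A k" R L bracket] by auto
  note nz = this[OF g(2)] this[OF h(2)]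
  show False
    using prime bracket_zero_generated_ideals[OF g(1) h(1) ne] nz
      graded_lie_ideal_generated[OF g(1)] graded_lie_ideal_generated[OF h(1)]
    unfolding graded_prime_def by blast
qed

end

section \<open>Groups generated by commuting elements\<close>

lemma (in group) subgroup_centralizer:
  assumes "S \<subseteq> carrier G"
  shows "subgroup {x \<in> carrier G. \<forall>s \<in> S. x \<otimes> s = s \<otimes> x} G"
proof (rule subgroupI)
  fix x assume x: "x \<in> {x \<in> carrier G. \<forall>s \<in> S. x \<otimes> s = s \<otimes> x}"
  have "inv x \<otimes> s = s \<otimes> inv x" if s: "s \<in> S" for s
  proof -
    have c: "x \<in> carrier G" "s \<in> carrier G" "x \<otimes> s = s \<otimes> x" using x s assms by auto
    have "inv x \<otimes> s = inv x \<otimes> (s \<otimes> x) \<otimes> inv x" using c(1,2) by (simp add: m_assoc)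
    also have "\<dots> = inv x \<otimes> (x \<otimes> s) \<otimes> inv x" using c(3) by simp
    also have "\<dots> = s \<otimes> inv x" using c(1,2) by (simp add: m_assoc[symmetric])
    finally show ?thesis .
  qed
  then show "inv x \<in> {x \<in> carrier G. \<forall>s \<in> S. x \<otimes> s = s \<otimes> x}" using x by auto
next
  fix x y
  assume "x \<in> {x \<in> carrier G. \<forall>s \<in> S. x \<otimes> s = s \<otimes> x}"
    and "y \<in> {x \<in> carrier G. \<forall>s \<in> S. x \<otimes> s = s \<otimes> x}"
  then have c: "x \<in> carrier G" "y \<in> carrier G"
    "\<And>s. s \<in> S \<Longrightarrow> x \<otimes> s = s \<otimes> x" "\<And>s. s \<in> S \<Longrightarrow> y \<otimes> s = s \<otimes> y" by auto
  have "x \<otimes> y \<otimes> s = s \<otimes> (x \<otimes> y)" if "s \<in> S" for s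
    using c(3,4)[OF that] c(1,2) subsetD[OF assms that] by (metis m_assoc)
  then show "x \<otimes> y \<in> {x \<in> carrier G. \<forall>s \<in> S. x \<otimes> s = s \<otimes> x}" using c by auto
next
  have "\<one> \<in> {x \<in> carrier G. \<forall>s \<in> S. x \<otimes> s = s \<otimes> x}" using assms by auto
  then show "{x \<in> carrier G. \<forall>s \<in> S. x \<otimes> s = s \<otimes> x} \<noteq> {}" by blast
qed auto

text \<open>The centralizer argument is applied twice: the centralizer of \<open>S\<close> contains
  \<open>S\<close>, hence is all of \<open>G\<close>; so \<open>S\<close> lies in the center, and
  the center is then all of \<open>G\<close>.\<close>

lemma (in group) comm_group_if_generators_commute:
  assumes gen: "generate G S = carrier G" and S: "S \<subseteq> carrier G"
    and comm: "\<And>x y. \<lbrakk>x \<in> S; y \<in> S\<rbrakk> \<Longrightarrow> x \<otimes> y = y \<otimes> x"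
  shows "comm_group G"
proof (rule group_comm_groupI)
  have "S \<subseteq> {x \<in> carrier G. \<forall>s \<in> S. x \<otimes> s = s \<otimes> x}"
    using S comm by blast
  from generate_subgroup_incl[OF this subgroup_centralizer[OF S]]
  have carr: "carrier G \<subseteq> {x \<in> carrier G. \<forall>s \<in> S. x \<otimes> s = s \<otimes> x}" unfolding gen .
  have "x \<otimes> s = s \<otimes> x" if "x \<in> S" "s \<in> carrier G" for x s
    using subsetD[OF carr that(2)] that(1) by simp
  then have "S \<subseteq> {x \<in> carrier G. \<forall>s \<in> carrier G. x \<otimes> s = s \<otimes> x}" using S by blast
  from generate_subgroup_incl[OF this subgroup_centralizer[OF subset_refl]]
  have central: "carrier G \<subseteq> {x \<in> carrier G. \<forall>s \<in> carrier G. x \<otimes> s = s \<otimes> x}" unfolding gen .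
  show "x \<otimes> y = y \<otimes> x" if "x \<in> carrier G" "y \<in> carrier G" for x y
    using central that by blast
qed

theorem mainTheorem1:
  fixes R :: "('r, 'm) ring_scheme"
    and L :: "('r, 'l, 'n) module_scheme"
    and bracket :: "'l \<Rightarrow> 'l \<Rightarrow> 'l"
    and G :: "('g, 'k) monoid_scheme"
    and A :: "'g \<Rightarrow> 'l set"
  assumes graded: "graded_lie_algebra R L bracket G A"
    and half: "\<one>\<^bsub>R\<^esub> \<oplus>\<^bsub>R\<^esub> \<one>\<^bsub>R\<^esub> \<in> Units R"
  shows "(\<forall>g \<in> carrier G. \<forall>g' \<in> carrier G. g \<otimes>\<^bsub>G\<^esub> g' \<noteq> g' \<otimes>\<^bsub>G\<^esub> g \<longrightarrow>
            bracket_zero L bracket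
              (generated_lie_ideal R L bracket (A g)) (generated_lie_ideal R L bracket (A g'))) \<and>
         (graded_prime R L bracket G A \<and> generate G (algebra_support L G A) = carrier G \<longrightarrow>
            comm_group G)"
proof -
  interpret graded_lie_algebra R L bracket G A by (rule graded)
  have "comm_group G"
    if "graded_prime R L bracket G A" "generate G (algebra_support L G A) = carrier G"
    using that algebra_support_nonzero_component(1) graded_prime_support_commutes
    by (intro G.comm_group_if_generators_commute[of "algebra_support L G A"]) auto
  then show ?thesis using bracket_zero_generated_ideals by blast
qed

end
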